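(* Let $\zeta$ denote the Riemann zeta function and $\Gamma(k)=(k-1)!$. (1) With $w_{1}=-1,\ w_{2}=15,\ w_{3}=-50,\ w_{4}=60,\ w_{5}=-24$, \[ \zeta(5)=\frac{(2\pi)^{4}}{(2^{5}-1)\Gamma(5)}\sum_{l=1}^{5}\int_{-\infty}^{\infty}\frac{w_{l}}{(e^{u}+1)^{l}\,u}\,du . \] (2) With $w_{1}=1,\ w_{2}=-63,\ w_{3}=602,\ w_{4}=-2100,\ w_{5}=3360,\ w_{6}=-2520,\ w_{7}=720$, \[ \zeta(7)=\frac{(2\pi)^{6}}{(2^{7}-1)\Gamma(7)}\sum_{l=1}^{7}\int_{-\infty}^{\infty}\frac{w_{l}}{(e^{u}+1)^{l}\,u}\,du . \] (In each case the combined integrand $\sum_l w_l/((e^u+1)^l u)$ has a removable singularity at $u=0$.) *)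

theory Defs
  imports "HOL-Complex_Analysis.Complex_Analysis"
begin

(* The Dirichlet series: this is the Riemann zeta function for Re s > 1 only; elsewhere
   the value carries no meaning. *)
definition riemann_zeta :: "complex \<Rightarrow> complex" where
  "riemann_zeta s = (\<Sum>n. 1 / of_nat (Suc n) powr s)"

(* Polymorphic so that the same formula gives both the integrand on the real line and its
   extension to the complex plane.  The list ws = [w_1, ..., w_k] is indexed from 0,
   hence ws ! (l - 1) for w_l. *)
definition combined_integrand ::
    "int list \<Rightarrow> 'a \<Rightarrow> 'a :: {real_normed_field, banach}" where
  "combined_integrand ws u =
     (\<Sum>l = 1..length ws. of_int (ws ! (l - 1)) / ((exp u + 1) ^ l * u))"

definition removable_singularity_at :: "(complex \<Rightarrow> complex) \<Rightarrow> complex \<Rightarrow> bool" where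
  "removable_singularity_at f z \<longleftrightarrow>
     (\<exists>g. g analytic_on {z} \<and> (\<forall>\<^sub>F w in at z. f w = g w))"

end

(*
  Write f(u) = 1 / (e^u + 1).  Since f' = f^2 - f, each derivative of f is a polynomial in f,
  and the two weighted sums are -f^(4) and f^(6), so the claim is a formula for the integral of
  f^(2m)(u) / u over the real line.  The reflection formula of the Digamma function gives
  f(s) = 1/2 + (i / 2 pi) (Digamma(1/2 + i s / 2 pi) - Digamma(1/2 - i s / 2 pi)), and
  differentiating 2m times turns this into
    f^(2m)(u) = -2 (2m)! sum_k Re (u - i a_k)^(-2m-1),   a_k = (2k+1) pi.
  Divided by u and integrated termwise, the k-th term contributes a_k^(-2m-1) times the constant
  integral of Re (u - i)^(-2m-1) / u, which is (-1)^m pi, and summing a_k^(-2m-1) over k gives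
  the zeta value.
*)
theory Submission
  imports Defs "HOL-Probability.Sinc_Integral" "HOL-Real_Asymp.Real_Asymp"
begin

section \<open>Integrals over the real line of inverse powers of u - i\<close>

lemma has_bochner_integral_inverse_1_plus_square:
  "has_bochner_integral lborel (\<lambda>x::real. inverse (1 + x\<^sup>2)) pi"
  using integrable_inverse_1_plus_square LBINT_inverse_1_plus_square
  by (simp add: has_bochner_integral_iff set_integrable_def interval_lebesgue_integral_def
      set_lebesgue_integral_def)

lemma of_real_neq_i [simp]: "complex_of_real u \<noteq> \<i>"
  by (simp add: complex_eq_iff)

lemma norm_real_minus_i: "norm (complex_of_real u - \<i>) = sqrt (1 + u\<^sup>2)"
  by (simp add: cmod_def add.commute)

text \<open>For exponents at least 2 the primitive is again an inverse power and vanishes at both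
  ends of the line; integrability follows from |u - i|^2 = 1 + u^2 and |u - i| \<ge> 1.\<close>

lemma has_bochner_integral_inverse_power_shift:
  "has_bochner_integral lborel (\<lambda>u. 1 / (complex_of_real u - \<i>) ^ Suc (Suc j)) 0"
proof -
  define f where "f = (\<lambda>u. 1 / (complex_of_real u - \<i>) ^ Suc (Suc j))"
  define F where "F = (\<lambda>u. - 1 / (of_nat (Suc j) * (complex_of_real u - \<i>) ^ Suc j))"
  have bound: "norm (f u) \<le> norm (inverse (1 + u\<^sup>2))" for u
  proof -
    have "1 \<le> norm (complex_of_real u - \<i>)"
      by (simp add: norm_real_minus_i)
    then have "norm (complex_of_real u - \<i>) ^ 2 \<le> norm (complex_of_real u - \<i>) ^ Suc (Suc j)"
      by (intro power_increasing) auto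
    then have "1 + u\<^sup>2 \<le> norm (complex_of_real u - \<i>) ^ Suc (Suc j)"
      by (simp add: norm_real_minus_i)
    then show ?thesis
      unfolding f_def norm_divide norm_power norm_one
      by (auto simp: inverse_eq_divide add_pos_nonneg
          intro!: divide_left_mono mult_pos_pos zero_less_power)
  qed
  have cont: "isCont f u" for u
    unfolding f_def by (intro continuous_intros) auto
  then have "f \<in> borel_measurable borel"
    by (intro borel_measurable_continuous_onI continuous_at_imp_continuous_on) auto
  then have int: "integrable lborel f"
    using bound has_bochner_integral_inverse_1_plus_square
    by (intro Bochner_Integration.integrable_bound[of lborel "\<lambda>x::real. inverse (1 + x\<^sup>2)" f])
       (auto simp: has_bochner_integral_iff)
  have F: "(F has_vector_derivative f u) (at u)" for u
  proof -
    have "((\<lambda>z. - 1 / (of_nat (Suc j) * (z - \<i>) ^ Suc j)) has_field_derivative f u)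
            (at (complex_of_real u))"
      unfolding f_def
      by (rule derivative_eq_intros refl | simp del: of_nat_Suc)+
    then show ?thesis
      unfolding F_def by (rule has_vector_derivative_real_field)
  qed
  have F_bound: "norm (F u) \<le> 1 / sqrt (1 + u\<^sup>2)" for u
  proof -
    have "1 * sqrt (1 + u\<^sup>2) ^ 1 \<le> real (Suc j) * sqrt (1 + u\<^sup>2) ^ Suc j"
      by (intro mult_mono power_increasing) auto
    then show ?thesis
      unfolding F_def norm_divide norm_mult norm_power norm_real_minus_i norm_of_nat norm_minus_cancel norm_one
      by (intro divide_left_mono mult_pos_pos zero_less_power) (auto simp: add_pos_nonneg)
  qed
  note F_null = Lim_null_comparison[OF always_eventually[OF allI[OF F_bound]]]
  have lim_top: "(F \<longlongrightarrow> 0) at_top"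
    by (rule F_null) real_asymp
  have lim_bot: "(F \<longlongrightarrow> 0) at_bot"
    by (rule F_null) real_asymp
  have "(LBINT u=-\<infinity>..\<infinity>. f u) = 0 - 0"
    using int lim_top lim_bot
    by (intro interval_integral_FTC_integrable[where F = F] F cont)
       (auto simp: set_integrable_def ereal_tendsto_simps)
  then show ?thesis
    using int unfolding has_bochner_integral_iff f_def
    by (simp add: interval_lebesgue_integral_def set_lebesgue_integral_def)
qed

text \<open>For an odd exponent the real part vanishes at u = 0, so the quotient has a removable
  singularity there. The value at 0 itself is the default of division by zero, hence the
  restrictions to u \<noteq> 0 below.\<close>

definition inverse_power_kernel :: "nat \<Rightarrow> real \<Rightarrow> real" where
  "inverse_power_kernel m u = Re (1 / (complex_of_real u - \<i>) ^ (2 * m + 1)) / u"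

lemma inverse_power_kernel_0:
  "u \<noteq> 0 \<Longrightarrow> inverse_power_kernel 0 u = inverse (1 + u\<^sup>2)"
  using add_pos_nonneg[of 1 "u\<^sup>2"]
  by (simp add: inverse_power_kernel_def Re_divide divide_simps)

text \<open>With \<open>z = u - i\<close> one has \<open>1 / (u z) = -i (1 / z - 1 / u)\<close>; applying this twice
  lowers the exponent by two, up to powers of \<open>1 / z\<close> whose integral vanishes.\<close>

lemma inverse_power_kernel_Suc:
  assumes "u \<noteq> 0"
  shows "inverse_power_kernel (Suc m) u =
    Re (- \<i> * (1 / (complex_of_real u - \<i>) ^ (2 * m + 3)) + 1 / (complex_of_real u - \<i>) ^ (2 * m + 2))
      - inverse_power_kernel m u"
proof -
  define z where "z = complex_of_real u - \<i>"
  have z: "z \<noteq> 0" "complex_of_real u = z + \<i>" "z + \<i> \<noteq> 0"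
    using assms by (auto simp: z_def)
  define p where "p = z ^ (2 * m + 1)"
  have p: "p \<noteq> 0" "z ^ (2 * m + 1) = p" "z ^ (2 * m + 2) = p * z" "z ^ (2 * m + 3) = p * z * z"
    using z(1) by (simp_all add: p_def numeral_3_eq_3)
  have "1 / z ^ (2 * m + 3) / of_real u =
      - \<i> * (1 / z ^ (2 * m + 3)) + 1 / z ^ (2 * m + 2) - 1 / z ^ (2 * m + 1) / of_real u"
    unfolding z(2) p(2-4) using z(1,3) p(1)
    by (simp add: divide_simps) (simp add: algebra_simps)
  from arg_cong[where f = Re, OF this] show ?thesis
    by (simp add: inverse_power_kernel_def Re_divide_of_real z_def numeral_3_eq_3
        flip: divide_divide_eq_left del: Re_divide)
qed

text \<open>The induction starts from the arctangent integral pi. In the recurrence the extra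
  inverse powers have exponent at least 2 and integrate to 0, so each step only flips the
  sign.\<close>

lemma has_bochner_integral_inverse_power_kernel:
  "has_bochner_integral lborel (inverse_power_kernel m) ((- 1) ^ m * pi)"
proof (induction m)
  case 0
  \<comment> \<open>The two sides differ at u = 0, where they are 1 and 0.\<close>
  have "AE u in lborel. inverse (1 + u\<^sup>2) = inverse_power_kernel 0 u"
    using AE_lborel_singleton[of 0] by eventually_elim (simp add: inverse_power_kernel_0)
  moreover have "inverse_power_kernel 0 \<in> borel_measurable lborel"
    unfolding inverse_power_kernel_def by measurable
  ultimately show ?case
    using has_bochner_integral_inverse_1_plus_square
    by (subst (asm) has_bochner_integral_cong_AE) (auto )
next
  case (Suc m)
  let ?g = "\<lambda>u. Re (- \<i> * (1 / (complex_of_real u - \<i>) ^ (2 * m + 3)) + 1 / (complex_of_real u - \<i>) ^ (2 * m + 2))"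
  have "has_bochner_integral lborel ?g (Re (- \<i> * 0 + 0))"
    using has_bochner_integral_inverse_power_shift[of "2 * m + 1"]
      has_bochner_integral_inverse_power_shift[of "2 * m"]
    by (intro has_bochner_integral_bounded_linear[OF bounded_linear_Re] has_bochner_integral_add
        has_bochner_integral_mult_right) (simp_all add: numeral_3_eq_3)
  then have "has_bochner_integral lborel (\<lambda>u. ?g u - inverse_power_kernel m u) (0 - (- 1) ^ m * pi)"
    using Suc by (intro has_bochner_integral_diff) simp_all
  moreover have "AE u in lborel. ?g u - inverse_power_kernel m u = inverse_power_kernel (Suc m) u"
    using AE_lborel_singleton[of 0] by eventually_elim (rule inverse_power_kernel_Suc[symmetric])
  moreover have "inverse_power_kernel k \<in> borel_measurable lborel" for k
    unfolding inverse_power_kernel_def by measurable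
  ultimately show ?case
    by (subst (asm) has_bochner_integral_cong_AE) auto
qed

text \<open>A consequence of |u - i| \<ge> 1; at a fixed u \<noteq> 0 it makes the rescaled series
  below converge absolutely.\<close>

lemma abs_inverse_power_kernel_le: "\<bar>inverse_power_kernel m u\<bar> \<le> 1 / \<bar>u\<bar>"
proof -
  have "1 \<le> norm (complex_of_real u - \<i>) ^ (2 * m + 1)"
    by (intro one_le_power) (simp add: norm_real_minus_i)
  then have "norm (1 / (complex_of_real u - \<i>) ^ (2 * m + 1)) \<le> 1"
    unfolding norm_divide norm_power norm_one
    by (simp add: divide_le_eq)
  then have "\<bar>Re (1 / (complex_of_real u - \<i>) ^ (2 * m + 1))\<bar> \<le> 1"
    using abs_Re_le_cmod order_trans by blast
  then show ?thesis
    unfolding inverse_power_kernel_def abs_divide by (intro divide_right_mono) auto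
qed

text \<open>Rescaling by \<open>a k\<close> multiplies an integral by \<open>a k\<close>, which
  turns the exponent \<open>2 * m + 2\<close> into \<open>2 * m + 1\<close>. Absolute values scale
  in the same way, so the integrals of the norms are summable and sum and integral may be
  exchanged.\<close>

lemma has_bochner_integral_suminf_inverse_power_kernel:
  fixes a :: "nat \<Rightarrow> real"
  assumes a: "\<And>k. a k > 0" and sum: "summable (\<lambda>k. 1 / a k ^ (2 * m + 1))"
  shows "has_bochner_integral lborel
    (\<lambda>u. \<Sum>k. inverse_power_kernel m (u / a k) / a k ^ (2 * m + 2))
    ((- 1) ^ m * pi * (\<Sum>k. 1 / a k ^ (2 * m + 1)))"
proof -
  define t where "t = (\<lambda>k u. inverse_power_kernel m (u / a k) / a k ^ (2 * m + 2))"
  note int = has_bochner_integral_inverse_power_kernel[of m, unfolded has_bochner_integral_iff]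
  \<comment> \<open>An arbitrary \<open>g\<close>, because this is applied both to the kernel and to
    its absolute value.\<close>
  have scale: "has_bochner_integral lborel (\<lambda>u. g (u / a k) / a k ^ (2 * m + 2)) (x * (1 / a k ^ (2 * m + 1)))"
    if "has_bochner_integral lborel g x" for g :: "real \<Rightarrow> real" and x k
  proof -
    have "has_bochner_integral lborel (\<lambda>u. g (0 + (1 / a k) * u)) (x /\<^sub>R \<bar>1 / a k\<bar>)"
      using that a[of k] by (subst lborel_has_bochner_integral_real_affine_iff[symmetric]) auto
    then have "has_bochner_integral lborel (\<lambda>u. g (0 + (1 / a k) * u) / a k ^ (2 * m + 2))
                 (x /\<^sub>R \<bar>1 / a k\<bar> / a k ^ (2 * m + 2))"
      by (rule has_bochner_integral_divide_zero)
    then show ?thesis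
      using a[of k] by (simp add: field_simps)
  qed
  have t: "has_bochner_integral lborel (t k) ((- 1) ^ m * pi * (1 / a k ^ (2 * m + 1)))" for k
    unfolding t_def by (intro scale has_bochner_integral_inverse_power_kernel)
  have "has_bochner_integral lborel (\<lambda>u. \<bar>inverse_power_kernel m u\<bar>)
      (LBINT u. \<bar>inverse_power_kernel m u\<bar>)"
    using int by (intro has_bochner_integral_integrable) auto
  from scale[OF this]
  have norm_t: "(LBINT u. norm (t k u)) = (LBINT u. \<bar>inverse_power_kernel m u\<bar>) * (1 / a k ^ (2 * m + 1))" for k
    using a[of k] by (simp add: has_bochner_integral_iff t_def abs_divide less_imp_le)
  have t_int: "integrable lborel (t k)" for k
    using t[of k] by (simp add: has_bochner_integral_iff)
  have AE: "AE u in lborel. summable (\<lambda>k. norm (t k u))"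
    using AE_lborel_singleton[of 0]
  proof eventually_elim
    case (elim u)
    have "norm (norm (t k u)) \<le> 1 / \<bar>u\<bar> * (1 / a k ^ (2 * m + 1))" for k
    proof -
      have "norm (norm (t k u)) \<le> (1 / \<bar>u / a k\<bar>) / a k ^ (2 * m + 2)"
        using a[of k] divide_right_mono[OF abs_inverse_power_kernel_le[of m "u / a k"],
            of "a k ^ (2 * m + 2)"]
        unfolding t_def by simp
      also have "\<dots> = 1 / \<bar>u\<bar> * (1 / a k ^ (2 * m + 1))"
        using a[of k] elim by (simp add: field_simps abs_divide)
      finally show ?thesis .
    qed
    then show ?case
      by (intro summable_comparison_test'[OF summable_mult[OF sum, of "1 / \<bar>u\<bar>"]])
  qed
  have sum_norm: "summable (\<lambda>k. LBINT u. norm (t k u))"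
    unfolding norm_t by (intro summable_mult sum)
  have "(LBINT u. \<Sum>k. t k u) = (\<Sum>k. (- 1) ^ m * pi * (1 / a k ^ (2 * m + 1)))"
    using t by (subst integral_suminf[OF t_int AE sum_norm]) (simp add: has_bochner_integral_iff)
  also have "\<dots> = (- 1) ^ m * pi * (\<Sum>k. 1 / a k ^ (2 * m + 1))"
    by (intro suminf_mult sum)
  finally show ?thesis
    using integrable_suminf[OF t_int AE sum_norm]
    unfolding has_bochner_integral_iff t_def by simp
qed

section \<open>The function f(s) = 1 / (exp s + 1) and its derivatives through Polygamma
  functions\<close>

text \<open>Differentiate rGamma(z) rGamma(1 - z) = sin(pi z) / pi in two ways; off the integers the
  product is nonzero and can be cancelled.\<close>

lemma Digamma_reflection:
  fixes z :: complex
  assumes "z \<notin> \<int>"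
  shows "Digamma (1 - z) - Digamma z = of_real pi * cot (of_real pi * z)"
proof -
  have nz: "z \<notin> \<int>\<^sub>\<le>\<^sub>0" "1 - z \<notin> \<int>\<^sub>\<le>\<^sub>0"
    using assms nonpos_Ints_Int Ints_diff[of 1 "1 - z"] by force+
  let ?R = "rGamma z * rGamma (1 - z)"
  have "((\<lambda>z. rGamma z * rGamma (1 - z)) has_field_derivative
      ?R * (Digamma (1 - z) - Digamma z)) (at z)"
    using nz by (auto intro!: derivative_eq_intros simp: algebra_simps)
  moreover have "((\<lambda>z. rGamma z * rGamma (1 - z)) has_field_derivative cos (of_real pi * z)) (at z)"
    unfolding rGamma_reflection_complex by (auto intro!: derivative_eq_intros)
  ultimately have "?R * (Digamma (1 - z) - Digamma z) = cos (of_real pi * z)"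
    by (rule DERIV_unique)
  moreover have "?R \<noteq> 0"
    using nz by (simp add: rGamma_eq_zero_iff)
  ultimately show ?thesis
    unfolding rGamma_reflection_complex cot_def by (simp add: field_simps)
qed

text \<open>The polynomial in f that represents the n-th derivative of f; the factor X^2 - X is f',
  contributed by the chain rule.\<close>

primrec fermi_deriv_poly :: "nat \<Rightarrow> complex poly" where
  "fermi_deriv_poly 0 = [:0, 1:]"
| "fermi_deriv_poly (Suc n) = pderiv (fermi_deriv_poly n) * [:0, -1, 1:]"

text \<open>For n = 0 this is f - 1/2 on the strip |Im s| < pi. Each differentiation brings out i /
  (2 pi), with the opposite sign in the second argument, whence \<open>(- 1) ^ n\<close>.\<close>

definition fermi_polygamma :: "nat \<Rightarrow> complex \<Rightarrow> complex" where
  "fermi_polygamma n s = (\<i> / (2 * pi)) ^ Suc n *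
     (Polygamma n (1 / 2 + \<i> * s / (2 * pi)) - (- 1) ^ n * Polygamma n (1 / 2 - \<i> * s / (2 * pi)))"

lemma Re_pos_not_nonpos_Int: "Re z > 0 \<Longrightarrow> z \<notin> \<int>\<^sub>\<le>\<^sub>0"
  by (auto elim!: nonpos_Ints_cases')

text \<open>On this strip both arguments have positive real part, 1/2 - Im s / (2 pi) and 1/2 + Im s
  / (2 pi), so they avoid the poles of Polygamma.\<close>

lemma half_plus_minus_not_nonpos_Int:
  assumes "\<bar>Im s\<bar> < pi"
  shows "1 / 2 + \<i> * s / (2 * pi) \<notin> \<int>\<^sub>\<le>\<^sub>0" "1 / 2 - \<i> * s / (2 * pi) \<notin> \<int>\<^sub>\<le>\<^sub>0"
proof -
  have "Re (1 / 2 + \<i> * s / (2 * pi)) > 0" "Re (1 / 2 - \<i> * s / (2 * pi)) > 0"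
    using assms by (auto simp: field_simps abs_less_iff)
  then show "1 / 2 + \<i> * s / (2 * pi) \<notin> \<int>\<^sub>\<le>\<^sub>0" "1 / 2 - \<i> * s / (2 * pi) \<notin> \<int>\<^sub>\<le>\<^sub>0"
    using Re_pos_not_nonpos_Int by blast+
qed

lemma exp_plus_1_nonzero:
  assumes "\<bar>Im s\<bar> < pi"
  shows "exp s + 1 \<noteq> 0"
proof
  assume "exp s + 1 = 0"
  then have "exp s = exp (\<i> * pi)"
    by (simp add: add_eq_0_iff2)
  then obtain n :: int where "s = \<i> * pi + of_int (2 * n) * pi * \<i>"
    unfolding exp_eq by blast
  then have "Im s = pi * (2 * n + 1)"
    by (simp add: algebra_simps)
  then have "\<bar>real_of_int (2 * n + 1)\<bar> < 1"
    using assms by (simp add: abs_mult)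
  then have "\<bar>2 * n + 1\<bar> < 1" by linarith
  then show False by presburger
qed

lemma has_field_derivative_fermi_polygamma:
  assumes "\<bar>Im s\<bar> < pi"
  shows "(fermi_polygamma n has_field_derivative fermi_polygamma (Suc n) s) (at s)"
  unfolding fermi_polygamma_def
  by (rule derivative_eq_intros refl half_plus_minus_not_nonpos_Int assms | simp)+
     (simp add: field_simps)

text \<open>The two Digamma arguments add up to 1, so reflection yields a cotangent; the shift by pi
  / 2 makes it a tangent of i s / 2, and the claim becomes f = 1/2 - tanh(s / 2) / 2.\<close>

lemma fermi_eq_polygamma:
  assumes "\<bar>Im s\<bar> < pi"
  shows "1 / (exp s + 1) = 1 / 2 + fermi_polygamma 0 s"
proof -
  define z where "z = 1 / 2 + \<i> * s / (2 * pi)"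
  \<comment> \<open>In the strip, Re z = 1/2 - Im s / (2 pi) lies strictly between 0 and 1.\<close>
  have "z \<notin> \<int>"
  proof
    assume "z \<in> \<int>"
    then obtain n where "z = of_int n" by (auto elim: Ints_cases)
    then have "Re z = of_int n" by simp
    then have "Im s = pi * (1 - 2 * of_int n)"
      by (simp add: z_def field_simps)
    then have "\<bar>real_of_int (1 - 2 * n)\<bar> < 1"
      using assms by (simp add: abs_mult)
    then have "\<bar>1 - 2 * n\<bar> < 1" by linarith
    then show False by presburger
  qed
  from Digamma_reflection[OF this]
  have "fermi_polygamma 0 s = - (\<i> / 2) * cot (of_real pi * z)"
    unfolding fermi_polygamma_def z_def by (simp add: field_simps)
  also have "of_real pi * z = pi / 2 + \<i> * s / 2"
    by (simp add: z_def field_simps)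
  also have "cot \<dots> = - tan (\<i> * s / 2)"
    by (simp add: cot_def tan_def sin_add cos_add)
  also have "tan (\<i> * s / 2) = \<i> * (exp s - 1) / (exp s + 1)"
  proof -
    have e: "exp s = exp (s / 2) * exp (s / 2)"
      by (simp flip: exp_add)
    show ?thesis
      using exp_plus_1_nonzero[OF assms] unfolding e
      by (simp add: tan_def sin_exp_eq cos_exp_eq exp_minus divide_simps) (auto simp: algebra_simps)
  qed
  finally have "fermi_polygamma 0 s = - (\<i> / 2) * - (\<i> * (exp s - 1) / (exp s + 1))" .
  also have "\<dots> = (1 / (exp s + 1)) - 1 / 2"
    using exp_plus_1_nonzero[OF assms] by (simp add: divide_simps) (simp add: algebra_simps)
  finally show ?thesis by simp
qed

lemma has_field_derivative_fermi_deriv_poly: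
  assumes "exp s + 1 \<noteq> (0 :: complex)"
  shows "((\<lambda>s. poly (fermi_deriv_poly n) (1 / (exp s + 1))) has_field_derivative
    poly (fermi_deriv_poly (Suc n)) (1 / (exp s + 1))) (at s)"
proof -
  have "((\<lambda>s. 1 / (exp s + 1)) has_field_derivative (1 / (exp s + 1))\<^sup>2 - 1 / (exp s + 1)) (at s)"
    using assms by (auto intro!: derivative_eq_intros simp: divide_simps power2_eq_square)
  from DERIV_chain2[OF poly_DERIV this] show ?thesis
    by (simp add: algebra_simps power2_eq_square)
qed

text \<open>Induction by differentiating both sides and using uniqueness of derivatives; the
  constant 1/2 disappears with the first derivative.\<close>

lemma poly_fermi_deriv_poly:
  assumes "\<bar>Im s\<bar> < pi"
  shows "poly (fermi_deriv_poly n) (1 / (exp s + 1)) = (if n = 0 then 1 / 2 else 0) + fermi_polygamma n s"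
  using assms
proof (induction n arbitrary: s)
  case 0
  then show ?case by (simp add: fermi_eq_polygamma)
next
  case (Suc n)
  let ?S = "{s. \<bar>Im s\<bar> < pi}"
  have "open ?S"
    by (intro open_Collect_less continuous_intros)
  have "((\<lambda>s. poly (fermi_deriv_poly n) (1 / (exp s + 1))) has_field_derivative
      poly (fermi_deriv_poly (Suc n)) (1 / (exp s + 1))) (at s)"
    by (intro has_field_derivative_fermi_deriv_poly exp_plus_1_nonzero Suc.prems)
  moreover have "((\<lambda>s. (if n = 0 then 1 / 2 else 0) + fermi_polygamma n s) has_field_derivative
      fermi_polygamma (Suc n) s) (at s)"
    using has_field_derivative_fermi_polygamma[OF Suc.prems]
    by (auto intro!: derivative_eq_intros)
  \<comment> \<open>The induction hypothesis holds on the whole open strip, so the two functions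
    agree near s and share their derivative.\<close>
  then have "((\<lambda>s. poly (fermi_deriv_poly n) (1 / (exp s + 1))) has_field_derivative
      fermi_polygamma (Suc n) s) (at s)"
    by (rule has_field_derivative_transform_within_open[OF _ \<open>open ?S\<close>]) (use Suc in auto)
  ultimately show ?case
    using DERIV_unique by fastforce
qed

section \<open>Partial fractions of the even derivatives\<close>

text \<open>The two Polygamma series are subtracted term by term. The factor \<open>u\<close>
  cancels the division inside the kernel, which lets the identity include u = 0.
  \<open>m > 0\<close> avoids Digamma, whose series is not a plain sum of inverse powers.\<close>

lemma fermi_polygamma_sums:
  assumes "m > 0"
  shows "(\<lambda>k. inverse_power_kernel m (u / ((2 * real k + 1) * pi)) / ((2 * real k + 1) * pi) ^ (2 * m + 2)
      * (- 2 * fact (2 * m)) * u)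
    sums Re (fermi_polygamma (2 * m) (of_real u))"
proof (cases "u = 0")
  \<comment> \<open>At u = 0 the two Polygamma arguments coincide, and the order is even, so their
    difference is 0.\<close>
  case True
  then show ?thesis by (simp add: fermi_polygamma_def)
next
  case False
  define n where "n = 2 * m + 1"
  define w where "w = 1 / 2 + \<i> * of_real u / (2 * pi)"
  define a where "a = (\<lambda>k. (2 * real k + 1) * pi)"
  \<comment> \<open>For real u the second argument is the conjugate of the first.\<close>
  have cnj_w: "cnj w = 1 / 2 - \<i> * of_real u / (2 * pi)"
    by (simp add: w_def)
  have w: "w \<noteq> 0" "cnj w \<noteq> 0"
    by (simp_all add: w_def complex_eq_iff)
  have "(\<lambda>k. inverse ((w + of_nat k) ^ n)) sums (- Polygamma (2 * m) w / fact (2 * m))"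
    using Polygamma_LIMSEQ[OF w(1), of "2 * m"] assms by (simp add: n_def)
  moreover have "(\<lambda>k. inverse ((cnj w + of_nat k) ^ n)) sums (- Polygamma (2 * m) (cnj w) / fact (2 * m))"
    using Polygamma_LIMSEQ[OF w(2), of "2 * m"] assms by (simp add: n_def)
  ultimately have "(\<lambda>k. inverse ((w + of_nat k) ^ n) - inverse ((cnj w + of_nat k) ^ n)) sums
      (- Polygamma (2 * m) w / fact (2 * m) - (- Polygamma (2 * m) (cnj w) / fact (2 * m)))"
    by (rule sums_diff)
  then have "(\<lambda>k. - fact (2 * m) * (\<i> / (2 * pi)) ^ n *
        (inverse ((w + of_nat k) ^ n) - inverse ((cnj w + of_nat k) ^ n))) sums
      (- fact (2 * m) * (\<i> / (2 * pi)) ^ n *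
        (- Polygamma (2 * m) w / fact (2 * m) - (- Polygamma (2 * m) (cnj w) / fact (2 * m))))"
    by (rule sums_mult)
  also have "- fact (2 * m) * (\<i> / (2 * pi)) ^ n *
        (- Polygamma (2 * m) w / fact (2 * m) - (- Polygamma (2 * m) (cnj w) / fact (2 * m)))
      = fermi_polygamma (2 * m) (of_real u)"
    unfolding fermi_polygamma_def cnj_w[symmetric] w_def[symmetric] n_def
    by (simp add: field_simps)
  finally have sums: "(\<lambda>k. Re (- fact (2 * m) * (\<i> / (2 * pi)) ^ n *
        (inverse ((w + of_nat k) ^ n) - inverse ((cnj w + of_nat k) ^ n)))) sums
      Re (fermi_polygamma (2 * m) (of_real u))"
    by (rule sums_Re)
  have "Re (- fact (2 * m) * (\<i> / (2 * pi)) ^ n *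
        (inverse ((w + of_nat k) ^ n) - inverse ((cnj w + of_nat k) ^ n))) =
      inverse_power_kernel m (u / a k) / a k ^ (2 * m + 2) * (- 2 * fact (2 * m)) * u" for k
  proof -
    have a: "a k > 0" by (simp add: a_def add_nonneg_pos)
    define q where "q = 1 / (of_real (u / a k) - \<i>) ^ n"
    have shift: "of_real (u / a k) - \<i> = (of_real u - \<i> * a k) / a k"
      using a by (simp add: field_simps)
    have cancel: "c ^ n * inverse ((c * x * d) ^ n) = 1 / d ^ n / x ^ n" if "c \<noteq> 0" for c x d :: complex
      using that by (simp add: power_mult_distrib divide_simps)
    \<comment> \<open>Because k + 1/2 = a_k / (2 pi), the left side is i / (2 pi) times u - i
      a_k.\<close>
    have W: "w + of_nat k = \<i> / (2 * pi) * a k * (of_real (u / a k) - \<i>)"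
      using a unfolding shift by (simp add: w_def) (simp add: a_def field_simps)
    have 1: "(\<i> / (2 * pi)) ^ n * inverse ((w + of_nat k) ^ n) = q / of_real (a k) ^ n"
      unfolding W q_def by (rule cancel) simp
    have "cnj w + of_nat k = cnj (w + of_nat k)"
      by simp
    also have "\<dots> = - (\<i> / (2 * pi) * a k * cnj (of_real (u / a k) - \<i>))"
      unfolding W by simp
    \<comment> \<open>Conjugation negates i / (2 pi) and \<open>n\<close> is odd, so a minus sign
      comes out and the difference of inverse powers becomes q + cnj q = 2 Re q.\<close>
    finally have 2: "(\<i> / (2 * pi)) ^ n * inverse ((cnj w + of_nat k) ^ n) = - (cnj q / of_real (a k) ^ n)"
      using cancel[of "\<i> / (2 * pi)" "a k" "cnj (of_real (u / a k) - \<i>)"]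
      by (simp add: q_def n_def)
    have "- fact (2 * m) * (\<i> / (2 * pi)) ^ n *
        (inverse ((w + of_nat k) ^ n) - inverse ((cnj w + of_nat k) ^ n)) =
        - fact (2 * m) * ((q + cnj q) / of_real (a k) ^ n)"
      unfolding right_diff_distrib mult.assoc 1 2 by (simp add: add_divide_distrib ring_distribs)
    also have "\<dots> = of_real (- fact (2 * m) * (2 * Re q / a k ^ n))"
      by (simp add: complex_add_cnj)
    finally have eq: "- fact (2 * m) * (\<i> / (2 * pi)) ^ n *
        (inverse ((w + of_nat k) ^ n) - inverse ((cnj w + of_nat k) ^ n)) =
        of_real (- fact (2 * m) * (2 * Re q / a k ^ n))" .
    have "inverse_power_kernel m (u / a k) = Re q / (u / a k)"
      by (simp add: inverse_power_kernel_def q_def n_def)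
    then show ?thesis
      unfolding eq Re_complex_of_real using a False by (simp add: n_def field_simps)
  qed
  with sums show ?thesis by (simp only: a_def)
qed

section \<open>Zeta values and the integral of the even derivatives divided by u\<close>

text \<open>Group the zeta series in pairs; the even denominators contribute 2^(-n) times the whole
  series, which is then subtracted.\<close>

lemma sums_odd_inverse_power:
  assumes "n > 1"
  shows "(\<lambda>k. 1 / (2 * real k + 1) ^ n) sums
    ((1 - 1 / 2 ^ n) * (\<Sum>k. 1 / real (Suc k) ^ n))"
proof -
  define f where "f = (\<lambda>k. 1 / real (Suc k) ^ n)"
  have "summable f"
    using inverse_power_summable[of n, where 'a = real] assms
    unfolding f_def by (subst summable_Suc_iff) (simp add: inverse_eq_divide)
  then have f: "f sums suminf f" by (rule summable_sums)
  have "(\<lambda>k. sum f {k * 2..<k * 2 + 2}) sums suminf f"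
    by (rule sums_group[OF f]) simp
  \<comment> \<open>Indices start at 0: index 2k has denominator 2k + 1, and index 2k + 1 has 2 (k +
    1), a scaled copy of the term \<open>f k\<close>.\<close>
  moreover have "sum f {k * 2..<k * 2 + 2} = 1 / (2 * real k + 1) ^ n + 1 / 2 ^ n * f k" for k
  proof -
    have "2 + real k * 2 = 2 * (1 + real k)" by simp
    then have "(2 + real k * 2) ^ n = 2 ^ n * (1 + real k) ^ n"
      by (simp only: power_mult_distrib)
    then show ?thesis
      by (simp add: f_def numeral_2_eq_2 add_ac mult.commute)
  qed
  ultimately have "(\<lambda>k. 1 / (2 * real k + 1) ^ n + 1 / 2 ^ n * f k) sums suminf f"
    by simp
  from sums_diff[OF this sums_mult[OF f, of "1 / 2 ^ n"]] show ?thesis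
    by (simp add: f_def algebra_simps)
qed

lemma riemann_zeta_of_nat:
  assumes "n > 1"
  shows "riemann_zeta (of_nat n) = complex_of_real (\<Sum>k. 1 / real (Suc k) ^ n)"
proof -
  have "summable (\<lambda>k. 1 / real (Suc k) ^ n)"
    using inverse_power_summable[of n, where 'a = real] assms
    by (subst summable_Suc_iff) (simp add: inverse_eq_divide)
  then show ?thesis
    unfolding riemann_zeta_def by (subst suminf_of_real) (auto simp del: of_nat_Suc)
qed

text \<open>Off 0 the integrand is -2 (2m)! times the kernel series with a_k = (2k + 1) pi, so its
  integral is a sum over odd denominators. \<open>Re\<close> only changes the type: the polynomials
  have integer coefficients and are real at real points.\<close>

lemma has_bochner_integral_fermi_deriv_poly:
  assumes "m > 0"
  shows "has_bochner_integral lborel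
    (\<lambda>u. Re (poly (fermi_deriv_poly (2 * m)) (1 / (exp (complex_of_real u) + 1))) / u)
    ((- 1) ^ Suc m * 2 * fact (2 * m) * (1 - 1 / 2 ^ (2 * m + 1)) / pi ^ (2 * m)
      * (\<Sum>k. 1 / real (Suc k) ^ (2 * m + 1)))"
proof -
  define a where "a = (\<lambda>k. (2 * real k + 1) * pi)"
  define Z where "Z = (1 - 1 / 2 ^ (2 * m + 1)) * (\<Sum>k. 1 / real (Suc k) ^ (2 * m + 1))"
  define S where "S = (\<lambda>u. \<Sum>k. inverse_power_kernel m (u / a k) / a k ^ (2 * m + 2))"
  have a_pos: "a k > 0" for k
    by (simp add: a_def add_nonneg_pos)
  have "(\<lambda>k. 1 / (2 * real k + 1) ^ (2 * m + 1) / pi ^ (2 * m + 1)) sums (Z / pi ^ (2 * m + 1))"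
    unfolding Z_def using assms by (intro sums_divide sums_odd_inverse_power) simp
  then have a_sums: "(\<lambda>k. 1 / a k ^ (2 * m + 1)) sums (Z / pi ^ (2 * m + 1))"
    by (simp only: a_def power_mult_distrib divide_divide_eq_left)
  have "has_bochner_integral lborel S ((- 1) ^ m * pi * (Z / pi ^ (2 * m + 1)))"
    using has_bochner_integral_suminf_inverse_power_kernel[OF a_pos sums_summable[OF a_sums]]
    unfolding S_def sums_unique[OF a_sums, symmetric] .
  then have "has_bochner_integral lborel (\<lambda>u. S u * (- 2 * fact (2 * m)))
      ((- 1) ^ m * pi * (Z / pi ^ (2 * m + 1)) * (- 2 * fact (2 * m)))"
    by (rule has_bochner_integral_mult_left)
  also have "(- 1) ^ m * pi * (Z / pi ^ (2 * m + 1)) * (- 2 * fact (2 * m)) =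
      (- 1) ^ Suc m * 2 * fact (2 * m) * Z / pi ^ (2 * m)"
    by simp
  finally have int: "has_bochner_integral lborel (\<lambda>u. S u * (- 2 * fact (2 * m)))
      ((- 1) ^ Suc m * 2 * fact (2 * m) * Z / pi ^ (2 * m))" .
  have S_eq: "S u * (- 2 * fact (2 * m)) = Re (poly (fermi_deriv_poly (2 * m)) (1 / (exp (complex_of_real u) + 1))) / u"
    if "u \<noteq> 0" for u
  proof -
    let ?c = "- 2 * fact (2 * m) * u"
    have "poly (fermi_deriv_poly (2 * m)) (1 / (exp (of_real u) + 1)) = fermi_polygamma (2 * m) (of_real u)"
      using poly_fermi_deriv_poly[of "of_real u" "2 * m"] assms by simp
    then have "(\<lambda>k. inverse_power_kernel m (u / a k) / a k ^ (2 * m + 2) * ?c) sums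
        Re (poly (fermi_deriv_poly (2 * m)) (1 / (exp (complex_of_real u) + 1)))"
      using fermi_polygamma_sums[OF assms, of u] by (simp add: a_def mult.assoc)
    \<comment> \<open>Dividing by \<open>?c\<close>, nonzero for u \<noteq> 0, leaves the bare
      kernel series.\<close>
    from sums_divide[OF this, of ?c]
    have "(\<lambda>k. inverse_power_kernel m (u / a k) / a k ^ (2 * m + 2)) sums
        (Re (poly (fermi_deriv_poly (2 * m)) (1 / (exp (complex_of_real u) + 1))) / ?c)"
      using that by simp
    then show ?thesis
      unfolding S_def using that by (simp add: sums_iff)
  qed
  have "AE u in lborel. S u * (- 2 * fact (2 * m)) =
      Re (poly (fermi_deriv_poly (2 * m)) (1 / (exp (complex_of_real u) + 1))) / u"
    using AE_lborel_singleton[of 0] by eventually_elim (rule S_eq)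
  moreover have "(\<lambda>u. Re (poly (fermi_deriv_poly (2 * m)) (1 / (exp (complex_of_real u) + 1))) / u) \<in> borel_measurable lborel"
    unfolding poly_altdef by measurable
  ultimately have "has_bochner_integral lborel
      (\<lambda>u. Re (poly (fermi_deriv_poly (2 * m)) (1 / (exp (complex_of_real u) + 1))) / u)
      ((- 1) ^ Suc m * 2 * fact (2 * m) * Z / pi ^ (2 * m))"
    using int borel_measurable_has_bochner_integral[OF int]
    by (subst (asm) has_bochner_integral_cong_AE) auto
  then show ?thesis
    by (simp add: Z_def mult_ac)
qed

section \<open>The combined integrand and the two zeta values\<close>

text \<open>Since h vanishes at 0, the quotient extends analytically with the value h'(0).\<close>

lemma removable_singularity_at_divide:
  assumes h: "h analytic_on {0}" "h 0 = 0"
  shows "removable_singularity_at (\<lambda>u. h u / u) 0"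
proof -
  define g where "g = (\<lambda>u. if u = 0 then deriv h 0 else h u / u)"
  have "g analytic_on {0}"
    by (rule pole_theorem_analytic_0[where a = 0, OF h(1)])
       (use h(2) in \<open>auto simp: g_def intro!: exI[of _ 1]\<close>)
  moreover have "\<forall>\<^sub>F u in at 0. h u / u = g u"
    unfolding g_def by (auto simp: eventually_at_filter)
  ultimately show ?thesis
    unfolding removable_singularity_at_def by blast
qed

lemma numeral_atLeastAtMost: "{1..5 :: nat} = {1, 2, 3, 4, 5}" "{1..7 :: nat} = {1, 2, 3, 4, 5, 6, 7}"
  by auto

lemma combined_integrand_eq:
  "combined_integrand ws u =
     (\<Sum>l = 1..length ws. of_int (ws ! (l - 1)) * (1 / (exp u + 1)) ^ l) / u"
  unfolding combined_integrand_def sum_divide_distrib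
  by (intro sum.cong) (simp_all add: power_divide)

lemma combined_integrand_of_real:
  "combined_integrand ws (complex_of_real u) = complex_of_real (combined_integrand ws u)"
  unfolding combined_integrand_def by (simp flip: exp_of_real)

text \<open>The weights are minus the coefficients of the fourth derivative as a polynomial in f; in
  absolute value they are (l - 1)! S(5, l), with S the Stirling numbers of the second kind.\<close>

lemma combined_integrand_5:
  "combined_integrand [-1, 15, -50, 60, -24] u =
     - (poly (fermi_deriv_poly (2 * 2)) (1 / (exp u + 1)) / u)"
  unfolding combined_integrand_eq minus_divide_left
  by (rule arg_cong2[where f = "(/)"])
     (simp_all add: numeral_atLeastAtMost eval_nat_numeral pderiv_pCons algebra_simps)

lemma combined_integrand_7:
  "combined_integrand [1, -63, 602, -2100, 3360, -2520, 720] u =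
     poly (fermi_deriv_poly (2 * 3)) (1 / (exp u + 1)) / u"
  unfolding combined_integrand_eq
  by (rule arg_cong2[where f = "(/)"])
     (simp_all add: numeral_atLeastAtMost eval_nat_numeral pderiv_pCons algebra_simps)

text \<open>The sign (-1)^(m+1) attached to the weights cancels the sign of the integral.
  \<open>zero\<close> says that the numerator vanishes at u = 0, where f = 1/2, and so makes the
  singularity removable.\<close>

lemma zeta_odd_eq_combined_integral:
  assumes "m > 0" and ws: "\<And>u :: complex. combined_integrand ws u =
     (- 1) ^ Suc m * (poly (fermi_deriv_poly (2 * m)) (1 / (exp u + 1)) / u)"
    and zero: "poly (fermi_deriv_poly (2 * m)) (1 / 2) = 0"
  shows "removable_singularity_at (combined_integrand ws) 0"
    "integrable lborel (combined_integrand ws :: real \<Rightarrow> real)"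
    "riemann_zeta (of_nat (2 * m + 1)) = complex_of_real
      ((2 * pi) ^ (2 * m) / ((2 ^ (2 * m + 1) - 1) * fact (2 * m)) * (LBINT u. combined_integrand ws u))"
proof -
  let ?p = "\<lambda>u. poly (fermi_deriv_poly (2 * m)) (1 / (exp u + 1))"
  have "?p analytic_on {0}"
    unfolding poly_altdef by (auto intro!: analytic_intros)
  then have "(\<lambda>u. (- 1) ^ Suc m * ?p u) analytic_on {0}"
    by (intro analytic_intros)
  then show "removable_singularity_at (combined_integrand ws) 0"
    using removable_singularity_at_divide[of "\<lambda>u. (- 1) ^ Suc m * ?p u"] zero
    by (simp add: ws[abs_def])
  have real: "(combined_integrand ws :: real \<Rightarrow> real) = (\<lambda>u. (- 1) ^ Suc m * (Re (?p (of_real u)) / u))"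
  proof
    fix u :: real
    \<comment> \<open>The complex identity \<open>ws\<close> is restricted to real u, and real parts
      are then compared.\<close>
    have "complex_of_real (combined_integrand ws u) = of_real ((- 1) ^ Suc m) * (?p (of_real u) / of_real u)"
      by (simp add: ws flip: combined_integrand_of_real)
    moreover have "Re (of_real c * z) = c * Re z" for c z
      by simp
    ultimately show "combined_integrand ws u = (- 1) ^ Suc m * (Re (?p (of_real u)) / u)"
      by (metis Re_complex_of_real Re_divide_of_real)
  qed
  define I where "I = 2 * fact (2 * m) * (1 - 1 / 2 ^ (2 * m + 1)) / pi ^ (2 * m)
      * (\<Sum>k. 1 / real (Suc k) ^ (2 * m + 1))"
  have "has_bochner_integral lborel (combined_integrand ws :: real \<Rightarrow> real)
      ((- 1) ^ Suc m * ((- 1) ^ Suc m * I))"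
    unfolding real I_def
    using has_bochner_integral_mult_right[OF has_bochner_integral_fermi_deriv_poly[OF assms(1)], of "(- 1) ^ Suc m"]
    by (simp add: mult_ac)
  then have int: "has_bochner_integral lborel (combined_integrand ws :: real \<Rightarrow> real) I"
    by (simp flip: mult.assoc power_add)
  then show "integrable lborel (combined_integrand ws :: real \<Rightarrow> real)"
    by (simp add: has_bochner_integral_iff)
  \<comment> \<open>This factor cancels against 2 * 2^(2m) * (1 - 2^(-(2m+1))) = 2^(2m+1) - 1, which
    arises from the prefactor and \<open>I\<close>.\<close>
  have "(2 :: real) ^ (2 * m + 1) - 1 \<noteq> 0"
    using one_less_power[of "2 :: real" "2 * m + 1"] by linarith
  then have "(2 * pi) ^ (2 * m) / ((2 ^ (2 * m + 1) - 1) * fact (2 * m)) * I =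
      (\<Sum>k. 1 / real (Suc k) ^ (2 * m + 1))"
    by (simp add: I_def power_mult_distrib divide_simps)
  then show "riemann_zeta (of_nat (2 * m + 1)) = complex_of_real
      ((2 * pi) ^ (2 * m) / ((2 ^ (2 * m + 1) - 1) * fact (2 * m)) * (LBINT u. combined_integrand ws u))"
    using riemann_zeta_of_nat[of "2 * m + 1"] assms(1) has_bochner_integral_integral_eq[OF int]
    by simp
qed

lemma Gamma_5_7: "Gamma (5 :: real) = fact 4" "Gamma (7 :: real) = fact 6"
  using Gamma_fact[of 4, where 'a = real] Gamma_fact[of 6, where 'a = real] by simp_all

theorem theorem4p1:
  shows
    "(removable_singularity_at (combined_integrand [-1, 15, -50, 60, -24]) 0 \<and>
      integrable lborel (combined_integrand [-1, 15, -50, 60, -24] :: real \<Rightarrow> real) \<and>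
      riemann_zeta 5 = complex_of_real
        ((2 * pi) ^ 4 / ((2 ^ 5 - 1) * Gamma 5) *
         (LBINT u. combined_integrand [-1, 15, -50, 60, -24] u))) \<and>
     (removable_singularity_at (combined_integrand [1, -63, 602, -2100, 3360, -2520, 720]) 0 \<and>
      integrable lborel (combined_integrand [1, -63, 602, -2100, 3360, -2520, 720] :: real \<Rightarrow> real) \<and>
      riemann_zeta 7 = complex_of_real
        ((2 * pi) ^ 6 / ((2 ^ 7 - 1) * Gamma 7) *
         (LBINT u. combined_integrand [1, -63, 602, -2100, 3360, -2520, 720] u)))"
proof (intro conjI)
  \<comment> \<open>Expected because f - 1/2 is odd, so its even derivatives vanish at 0, where f =
    1/2.\<close>
  have zero: "poly (fermi_deriv_poly (2 * 2)) (1 / 2) = 0" "poly (fermi_deriv_poly (2 * 3)) (1 / 2) = 0"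
    by (simp_all add: eval_nat_numeral pderiv_pCons)
  \<comment> \<open>Here m = 2 and m = 3, with signs -1 and +1.\<close>
  note case5 = zeta_odd_eq_combined_integral[OF _ _ zero(1), of "[-1, 15, -50, 60, -24]"]
  note case7 = zeta_odd_eq_combined_integral[OF _ _ zero(2), of "[1, -63, 602, -2100, 3360, -2520, 720]"]
  show "removable_singularity_at (combined_integrand [-1, 15, -50, 60, -24]) 0"
    by (rule case5(1)) (simp_all add: combined_integrand_5)
  show "integrable lborel (combined_integrand [-1, 15, -50, 60, -24] :: real \<Rightarrow> real)"
    by (rule case5(2)) (simp_all add: combined_integrand_5)
  show "riemann_zeta 5 = complex_of_real ((2 * pi) ^ 4 / ((2 ^ 5 - 1) * Gamma 5) *
      (LBINT u. combined_integrand [-1, 15, -50, 60, -24] u))"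
    using case5(3) by (simp add: combined_integrand_5 Gamma_5_7)
  show "removable_singularity_at (combined_integrand [1, -63, 602, -2100, 3360, -2520, 720]) 0"
    by (rule case7(1)) (simp_all add: combined_integrand_7)
  show "integrable lborel (combined_integrand [1, -63, 602, -2100, 3360, -2520, 720] :: real \<Rightarrow> real)"
    by (rule case7(2)) (simp_all add: combined_integrand_7)
  show "riemann_zeta 7 = complex_of_real ((2 * pi) ^ 6 / ((2 ^ 7 - 1) * Gamma 7) *
      (LBINT u. combined_integrand [1, -63, 602, -2100, 3360, -2520, 720] u))"
    using case7(3) by (simp add: combined_integrand_7 Gamma_5_7)
qed

end
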